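(* Let $\mathcal{X}\subset\mathbb{R}^2$ be a set of $m$ points that are the vertices of a convex polygon, and let $\mathcal{H}$ be the set of restrictions to $\mathcal{X}$ of linear classifiers on $\mathbb{R}^2$ that satisfy $\frac{1}{|\mathcal{X}|}\sum_{x\in\mathcal{X}}h(x)\in[\frac14,\frac34]$; let $n=|\mathcal{H}|$. Then the worst-case query cost of Generalized Binary Search on $(\mathcal{H},\mathcal{X})$ is at most $$\frac{\log_2 n}{-\log_2(1-1/5)}\le 3.2\log_2 n .$$
   Context: A linear classifier on $\mathbb{R}^2$ is a function $x\mapsto\mathbf{1}[w\cdot x+b>0]$ with $w\in\mathbb{R}^2$, $b\in\mathbb{R}$. The points are distinct, each is a genuine vertex (extreme point) of the polygon, and $m\ge3$. Hypotheses are functions $\mathcal{X}\to\{0,1\}$; the elements of $\mathcal{X}$ are the tests. Generalized Binary Search: there is an unknown $h^*\in\mathcal{H}$. Start with $V=\mathcal{H}$. While $|V|>1$: choose a test $x\in\mathcal{X}$ minimizing $\left|\frac{1}{|V|}\sum_{h\in V}h(x)-\frac12\right|$ (ties broken arbitrarily), observe $y=h^*(x)$, and replace $V$ by $\{h\in V: h(x)=y\}$. The worst-case query cost is the maximum over $h^*\in\mathcal{H}$ of the number of queries made until $|V|=1$. *)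

theory Defs
  imports "HOL-Analysis.Analysis" "HOL-Library.Extended_Real"
begin

definition linear_classifier :: "real ^ 2 \<Rightarrow> real \<Rightarrow> real ^ 2 \<Rightarrow> nat" where
  "linear_classifier w b x = of_bool (w \<bullet> x + b > 0)"

text \<open>Functions on \<open>X\<close> are represented as extensional functions (\<^const>\<open>restrict\<close>), so that two
  classifiers agreeing on \<open>X\<close> give the same hypothesis.\<close>

definition balanced_linear_hyps :: "(real ^ 2) set \<Rightarrow> (real ^ 2 \<Rightarrow> nat) set" where
  "balanced_linear_hyps X =
     {h. (\<exists>w b. h = restrict (linear_classifier w b) X) \<and>
         (\<Sum>x\<in>X. real (h x)) / real (card X) \<in> {1/4..3/4}}"

definition gbs_test :: "'a set \<Rightarrow> ('a \<Rightarrow> nat) set \<Rightarrow> 'a \<Rightarrow> bool" where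
  "gbs_test X V x \<longleftrightarrow>
     is_arg_min (\<lambda>x. \<bar>(\<Sum>h\<in>V. real (h x)) / real (card V) - 1/2\<bar>) (\<lambda>x. x \<in> X) x"

text \<open>\<open>gbs_reach X H hs k V\<close>: some execution with target \<open>hs\<close> has version space \<open>V\<close> after \<open>k\<close>
  queries. All ways of breaking ties, including history-dependent ones, are covered.\<close>

inductive gbs_reach :: "'a set \<Rightarrow> ('a \<Rightarrow> nat) set \<Rightarrow> ('a \<Rightarrow> nat) \<Rightarrow> nat \<Rightarrow> ('a \<Rightarrow> nat) set \<Rightarrow> bool"
  for X :: "'a set" and H :: "('a \<Rightarrow> nat) set" and hs :: "'a \<Rightarrow> nat" where
  init: "gbs_reach X H hs 0 H"
| query: "gbs_reach X H hs k V \<Longrightarrow> card V > 1 \<Longrightarrow> gbs_test X V x \<Longrightarrow>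
    gbs_reach X H hs (Suc k) {h \<in> V. h x = hs x}"

text \<open>The supremum of the query counts attained before or at termination is the length of the longest
  execution. For finite \<open>H\<close> and finite nonempty \<open>X\<close>, an execution can be extended until the version
  space is a singleton, so a loop that fails to terminate makes the cost \<open>\<infinity>\<close>.\<close>

definition gbs_worst_case_cost :: "('a \<Rightarrow> nat) set \<Rightarrow> 'a set \<Rightarrow> enat" where
  "gbs_worst_case_cost H X = (SUP hs\<in>H. SUP k\<in>{k. \<exists>V. gbs_reach X H hs k V}. enat k)"

end

(* In counterclockwise order of the vertices every hypothesis is a cyclic arc, since the diagonals of a
   convex quadrilateral cross. Let V be a version space. By the balance condition the mean over the tests
   x of the fraction p(x) of V labelling x positively lies in [1/4, 3/4]. If no p(x) were in [1/5, 4/5],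
   both p(x) < 1/5 and p(x) > 4/5 would occur, so the majority label changes at some step around the
   polygon and changes back at another. More than a fifth of V agrees with the majority at the four
   vertices next to these two changes, but at most one arc does, so |V| < 5; then all of V agrees with the
   majority everywhere and |V| = 1. Hence every query leaves at most 4/5 of V. *)
theory Submission
  imports Defs
begin

section \<open>Cyclic order of the vertices\<close>

text \<open>Twice the signed area of the triangle \<open>a b c\<close>, positive exactly when its
  vertices run counterclockwise.\<close>

definition orient :: "real ^ 2 \<Rightarrow> real ^ 2 \<Rightarrow> real ^ 2 \<Rightarrow> real" where
  "orient a b c = (b$1 - a$1) * (c$2 - a$2) - (b$2 - a$2) * (c$1 - a$1)"

text \<open>Each of four points in the plane is weighted by the signed area of the triangle on the
  other three. If all weights are positive, both sides are, up to scaling, the point where the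
  diagonals \<open>a c\<close> and \<open>b d\<close> cross.\<close>

lemma orient_affine_dependency:
  "orient b c d *\<^sub>R a + orient a b d *\<^sub>R c = orient a c d *\<^sub>R b + orient a b c *\<^sub>R d"
  "orient b c d + orient a b d = orient a c d + orient a b c"
  unfolding orient_def by (simp_all add: vec_eq_iff forall_2 algebra_simps)

lemma extreme_point_not_in_convex_hull:
  assumes "convex P" "x extreme_point_of P" "S \<subseteq> P" "x \<notin> S"
  shows "x \<notin> convex hull S"
proof -
  have "convex (P - {x})"
    using assms extreme_point_of_stillconvex by blast
  then have "convex hull S \<subseteq> P - {x}"
    using assms by (intro hull_minimal) auto
  then show ?thesis by blast
qed

text \<open>The equation places \<open>x\<close> on the segment from \<open>o'\<close> to
  \<open>y\<close>, which is impossible for an extreme point other than its ends. Thus no two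
  vertices are seen from \<open>o'\<close> in the same direction.\<close>

lemma ray_from_extreme_point_inj:
  fixes o' x y w :: "'a::euclidean_space"
  assumes "convex P" "x extreme_point_of P" "o' \<in> P" "y \<in> P" "x \<noteq> o'" "x \<noteq> y"
    and le: "0 < \<alpha>" "\<alpha> \<le> \<beta>"
    and eq: "\<beta> *\<^sub>R (x - o') = \<alpha> *\<^sub>R (y - o')"
  shows False
proof -
  have "x - o' = (1 / \<beta>) *\<^sub>R (\<beta> *\<^sub>R (x - o'))"
    using le by simp
  also have "\<dots> = (\<alpha> / \<beta>) *\<^sub>R (y - o')"
    unfolding eq by simp
  finally have "x = (1 - \<alpha> / \<beta>) *\<^sub>R o' + (\<alpha> / \<beta>) *\<^sub>R y"
    by (simp add: algebra_simps)
  moreover have "0 \<le> \<alpha> / \<beta>" "\<alpha> / \<beta> \<le> 1"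
    using le by auto
  ultimately have "x \<in> convex hull {o', y}"
    unfolding convex_hull_2_alt by (auto simp: algebra_simps)
  then show False
    using extreme_point_not_in_convex_hull[of P x "{o', y}"] assms by auto
qed

text \<open>Otherwise the affine dependency would write \<open>b\<close> as a convex combination of
  \<open>o'\<close>, \<open>a\<close> and \<open>c\<close>. This reduces the orientation of
  arbitrary triples to that of triples starting at a fixed vertex \<open>o'\<close>.\<close>

lemma orient_pos_if_fan:
  assumes "convex P" "b extreme_point_of P" "{o', a, c} \<subseteq> P" "b \<notin> {o', a, c}"
    and pos: "orient o' a b > 0" "orient o' b c > 0" "orient o' a c > 0"
  shows "orient a b c > 0"
proof (rule ccontr)
  assume neg: "\<not> orient a b c > 0"
  define r where "r = orient o' a c"
  have "orient a b c *\<^sub>R o' + r *\<^sub>R b = orient o' b c *\<^sub>R a + orient o' a b *\<^sub>R c"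
    using orient_affine_dependency(1)[of a b c o'] by (simp add: r_def)
  then have "r *\<^sub>R b = (- orient a b c) *\<^sub>R o' + orient o' b c *\<^sub>R a + orient o' a b *\<^sub>R c"
    by (simp add: algebra_simps)
  then have "(1/r) *\<^sub>R (r *\<^sub>R b) = (1/r) *\<^sub>R ((- orient a b c) *\<^sub>R o' + orient o' b c *\<^sub>R a + orient o' a b *\<^sub>R c)"
    by simp
  then have b: "b = (- orient a b c / r) *\<^sub>R o' + (orient o' b c / r) *\<^sub>R a + (orient o' a b / r) *\<^sub>R c"
    using pos by (simp add: r_def algebra_simps)
  have "- orient a b c + orient o' b c + orient o' a b = r"
    using orient_affine_dependency(2)[of a b c o'] by (simp add: r_def)
  then have "(- orient a b c + orient o' b c + orient o' a b) / r = 1"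
    using pos by (simp add: r_def)
  then have "- orient a b c / r + orient o' b c / r + orient o' a b / r = 1"
    by (simp only: add_divide_distrib)
  moreover have "0 \<le> - orient a b c / r" "0 \<le> orient o' b c / r" "0 \<le> orient o' a b / r"
    using pos neg by (auto simp: r_def intro: divide_nonneg_pos divide_nonpos_pos)
  ultimately have "b \<in> convex hull {o', a, c}"
    unfolding convex_hull_3 using b by blast
  then show False
    using extreme_point_not_in_convex_hull[of P b "{o', a, c}"] assms by auto
qed

text \<open>The vertices are sorted by the angle at which one of them, \<open>o'\<close>, sees the
  others.\<close>

lemma exists_counterclockwise_enumeration:
  fixes P X :: "(real ^ 2) set"
  assumes "polytope P" and X: "X = {v. v extreme_point_of P}" and "X \<noteq> {}"
  obtains c where "bij_betw c {..<card X} X"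
    "\<And>i j k. i < j \<Longrightarrow> j < k \<Longrightarrow> k < card X \<Longrightarrow> orient (c i) (c j) (c k) > 0"
proof -
  have conv: "convex P"
    using assms polytope_imp_convex by blast
  have XP: "X \<subseteq> P"
    by (auto simp: X extreme_point_of_def)
  have finX: "finite X"
    using finite_polyhedron_extreme_points[of P] polytope_imp_polyhedron[OF assms(1)] by (simp add: X)
  obtain o' where o': "o' \<in> X" using assms by auto
  \<comment> \<open>Faces of a polyhedron are exposed, so some supporting line meets
    \<open>P\<close> only in \<open>o'\<close> and all other vertices lie strictly on one
    side.\<close>
  then have "{o'} exposed_face_of P"
    using polytope_imp_polyhedron[OF assms(1)]
    by (auto simp: X face_of_singleton exposed_face_of_polyhedron)
  then obtain w t where w: "P \<subseteq> {x. w \<bullet> x \<le> t}" "{o'} = P \<inter> {x. w \<bullet> x = t}"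
    unfolding exposed_face_of_def by auto
  \<comment> \<open>Up to the factor \<open>norm w\<close>, \<open>\<alpha>\<close> and
    \<open>\<gamma>\<close> are the coordinates of \<open>o' - x\<close> along \<open>w\<close> and
    along \<open>w\<close> turned by a right angle. Since \<open>\<alpha>\<close> is positive on
    \<open>Y\<close>, \<open>key\<close> is the tangent of an angle strictly between minus and plus
    a right angle, and so increases with it.\<close>
  define \<alpha> where "\<alpha> x = w \<bullet> (o' - x)" for x
  define \<gamma> where "\<gamma> x = w$1 * (o'$2 - x$2) - w$2 * (o'$1 - x$1)" for x :: "real ^ 2"
  define key where "key x = \<gamma> x / \<alpha> x" for x
  define Y where "Y = X - {o'}"
  have \<alpha>_pos: "\<alpha> x > 0" if "x \<in> Y" for x
  proof -
    have "x \<in> P" "x \<noteq> o'" using that XP by (auto simp: Y_def)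
    then have "w \<bullet> x < t" using w by fastforce
    moreover have "w \<bullet> o' = t" using w by auto
    ultimately show ?thesis by (simp add: \<alpha>_def inner_diff_right)
  qed
  have \<alpha>_alt: "\<alpha> x = w$1 * (o'$1 - x$1) + w$2 * (o'$2 - x$2)" for x
    by (simp add: \<alpha>_def inner_vec_def sum_2)
  \<comment> \<open>If \<open>o'\<close> is the only vertex, \<open>w\<close> may be 0, hence the
    condition.\<close>
  have w_pos: "(w$1)^2 + (w$2)^2 > 0" if ne: "Y \<noteq> {}"
  proof -
    obtain x where "x \<in> Y" using ne by auto
    then have "w \<noteq> 0" using \<alpha>_pos[of x] by (auto simp: \<alpha>_def)
    then show ?thesis by (simp add: vec_eq_iff forall_2 sum_power2_gt_zero_iff)
  qed
  have cross: "\<alpha> x * \<gamma> y - \<gamma> x * \<alpha> y = ((w$1)^2 + (w$2)^2) * orient o' x y" for x y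
    unfolding \<alpha>_alt \<gamma>_def orient_def by (simp add: algebra_simps power2_eq_square)
  have key_less: "orient o' x y > 0" if "x \<in> Y" "y \<in> Y" "key x < key y" for x y
  proof -
    have "\<gamma> x * \<alpha> y < \<gamma> y * \<alpha> x"
      using that \<alpha>_pos[of x] \<alpha>_pos[of y] by (simp add: key_def divide_simps mult.commute split: if_splits)
    then have "((w$1)^2 + (w$2)^2) * orient o' x y > 0"
      using cross[of x y] by (simp add: algebra_simps)
    moreover have "(w$1)^2 + (w$2)^2 > 0" using w_pos that(1) by blast
    ultimately show ?thesis by (metis zero_less_mult_pos)
  qed
  have inj: "inj_on key Y"
  proof (rule inj_onI, rule ccontr)
    fix x y assume xy: "x \<in> Y" "y \<in> Y" "key x = key y" "x \<noteq> y"
    then have "\<alpha> x * \<gamma> y = \<gamma> x * \<alpha> y"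
      using \<alpha>_pos[of x] \<alpha>_pos[of y] by (simp add: key_def divide_simps mult.commute split: if_splits)
    \<comment> \<open>The vector on the left is orthogonal to \<open>w\<close>, hence a multiple of
      \<open>w\<close> turned by a right angle.\<close>
    moreover have "((w$1)^2 + (w$2)^2) *\<^sub>R (\<alpha> y *\<^sub>R (x - o') - \<alpha> x *\<^sub>R (y - o'))
        = (\<alpha> x * \<gamma> y - \<gamma> x * \<alpha> y) *\<^sub>R (\<chi> i. if i = 1 then - w$2 else w$1)"
      unfolding \<alpha>_alt \<gamma>_def by (simp add: vec_eq_iff forall_2 algebra_simps power2_eq_square)
    ultimately have "((w$1)^2 + (w$2)^2) *\<^sub>R (\<alpha> y *\<^sub>R (x - o') - \<alpha> x *\<^sub>R (y - o')) = 0"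
      by simp
    moreover have "(w$1)^2 + (w$2)^2 \<noteq> 0" using w_pos xy(1) by force
    ultimately have eq: "\<alpha> y *\<^sub>R (x - o') = \<alpha> x *\<^sub>R (y - o')"
      by (metis scaleR_eq_0_iff right_minus_eq)
    have *: "x extreme_point_of P" "y extreme_point_of P" "x \<in> P" "y \<in> P" "x \<noteq> o'" "y \<noteq> o'" "o' \<in> P"
      using xy XP o' by (auto simp: Y_def X)
    show False
    \<comment> \<open>Both points lie on one ray from \<open>o'\<close>; the nearer one would lie
      between \<open>o'\<close> and the other.\<close>
    proof (cases "\<alpha> x \<le> \<alpha> y")
      case True
      then show False
        using ray_from_extreme_point_inj[OF conv *(1) *(7) *(4) *(5) xy(4) \<alpha>_pos[OF xy(1)] _ eq] by auto
    next
      case False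
      then show False
        using ray_from_extreme_point_inj[OF conv *(2) *(7) *(3) *(6) xy(4)[symmetric] \<alpha>_pos[OF xy(2)] _ eq[symmetric]]
        by auto
    qed
  qed
  define ks where "ks = sorted_list_of_set (key ` Y)"
  have finY: "finite Y" using finX by (simp add: Y_def)
  have len: "length ks = card Y"
    using inj finY by (simp add: ks_def card_image)
  have cardX: "card X = Suc (card Y)"
    using o' finX by (metis Y_def card_Suc_Diff1)
  \<comment> \<open>Index 0 is the base vertex, so indices into \<open>ks\<close> are shifted by
    one.\<close>
  define c where "c i = (case i of 0 \<Rightarrow> o' | Suc j \<Rightarrow> inv_into Y key (ks ! j))" for i
  have setks: "set ks = key ` Y" using finY by (simp add: ks_def)
  have cS: "c (Suc j) \<in> Y" "key (c (Suc j)) = ks ! j" if "j < card Y" for j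
  proof -
    have "ks ! j \<in> key ` Y" using that len setks nth_mem by fastforce
    then show "c (Suc j) \<in> Y" "key (c (Suc j)) = ks ! j"
      by (auto simp: c_def inv_into_into f_inv_into_f)
  qed
  have fan: "orient o' (c (Suc i)) (c (Suc j)) > 0" if "i < j" "j < card Y" for i j
  proof (rule key_less)
    show "key (c (Suc i)) < key (c (Suc j))"
      using that cS len strict_sorted_list_of_set[of "key ` Y"]
      by (auto simp: ks_def sorted_wrt_iff_nth_less)
  qed (use that cS in auto)
  have ord: "orient (c i) (c j) (c k) > 0" if "i < j" "j < k" "k < card X" for i j k
  proof -
    have "j \<noteq> 0" "k \<noteq> 0" using that by auto
    then obtain j' k' where jk: "j = Suc j'" "k = Suc k'" by (metis not0_implies_Suc)
    show ?thesis
    proof (cases i)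
      case 0
      then show ?thesis using fan[of j' k'] that jk cardX by (simp add: c_def[of 0])
    next
      case (Suc i')
      have Y: "c i \<in> Y" "c j \<in> Y" "c k \<in> Y"
        using cS that cardX jk Suc by auto
      have ne: "c j \<noteq> c i" "c j \<noteq> c k"
        using fan[of i' j'] fan[of j' k'] that cardX jk Suc by (auto simp: orient_def)
      show ?thesis
      proof (rule orient_pos_if_fan[where P = P and o' = o'])
        show "c j extreme_point_of P" using Y by (auto simp: Y_def X)
        show "{o', c i, c k} \<subseteq> P" using Y o' XP by (auto simp: Y_def)
        show "c j \<notin> {o', c i, c k}" using ne Y by (auto simp: Y_def)
      qed (use conv fan that cardX jk Suc in auto)
    qed
  qed
  have injc: "inj_on c {..<card X}"
  proof (rule linorder_inj_onI)
    fix i j assume ij: "i < j" "i \<in> {..<card X}" "j \<in> {..<card X}"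
    obtain j' where j: "j = Suc j'" using ij(1) by (cases j) auto
    show "c i \<noteq> c j"
    proof (cases i)
      case 0
      then show ?thesis using cS(1)[of j'] j ij cardX by (auto simp: c_def[of 0] Y_def)
    next
      case (Suc i')
      then show ?thesis using fan[of i' j'] j ij cardX by (auto simp: orient_def)
    qed
  qed auto
  have "c i \<in> X" if "i < card X" for i
  proof (cases i)
    case 0
    then show ?thesis using o' by (simp add: c_def[of 0])
  next
    case (Suc j)
    then show ?thesis using that cS(1)[of j] cardX by (simp add: Y_def)
  qed
  then have "c ` {..<card X} \<subseteq> X" by auto
  then have "bij_betw c {..<card X} X"
    using injc finX by (simp add: bij_betw_def card_image card_subset_eq)
  then show ?thesis using ord that by blast
qed

section \<open>Labellings without alternation\<close>

text \<open>With \<open>0, ..., m - 1\<close> arranged in a circle, this says that the indices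
  labelled true form a cyclic arc, possibly empty or full.\<close>

definition alternation_free :: "nat \<Rightarrow> (nat \<Rightarrow> bool) \<Rightarrow> bool" where
  "alternation_free m g \<longleftrightarrow>
     \<not> (\<exists>i j k l. i < j \<and> j < k \<and> k < l \<and> l < m \<and> g i = g k \<and> g j = g l \<and> g i \<noteq> g j)"

lemma alternation_freeD:
  "alternation_free m g \<Longrightarrow> i < j \<Longrightarrow> j < k \<Longrightarrow> k < l \<Longrightarrow> l < m \<Longrightarrow> g i = g k \<Longrightarrow> g j = g l \<Longrightarrow> g i = g j"
  unfolding alternation_free_def by blast

text \<open>The diagonals of a convex quadrilateral cross, so an affine function cannot be positive at the
  ends of one diagonal and nonpositive at the ends of the other.\<close>

lemma affine_no_crossing:
  assumes "orient p q r > 0" "orient p q s > 0" "orient p r s > 0" "orient q r s > 0"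
    and pos: "w \<bullet> p + b > 0" "w \<bullet> r + b > 0" and neg: "w \<bullet> q + b \<le> 0" "w \<bullet> s + b \<le> 0"
  shows False
proof -
  have "orient q r s * (w \<bullet> p) + orient p q s * (w \<bullet> r) = orient p r s * (w \<bullet> q) + orient p q r * (w \<bullet> s)"
    using arg_cong[OF orient_affine_dependency(1)[of q r s p], of "\<lambda>v. w \<bullet> v"]
    by (simp add: inner_add_right)
  moreover have "orient q r s * b + orient p q s * b = orient p r s * b + orient p q r * b"
    using orient_affine_dependency(2)[of q r s p] by (simp flip: distrib_right)
  ultimately have "orient q r s * (w \<bullet> p + b) + orient p q s * (w \<bullet> r + b)
      = orient p r s * (w \<bullet> q + b) + orient p q r * (w \<bullet> s + b)"
    by (simp add: algebra_simps)
  moreover have "orient q r s * (w \<bullet> p + b) > 0" "orient p q s * (w \<bullet> r + b) > 0"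
    "orient p r s * (w \<bullet> q + b) \<le> 0" "orient p q r * (w \<bullet> s + b) \<le> 0"
    using assms by (auto intro: mult_nonneg_nonpos)
  ultimately show False by linarith
qed

text \<open>Of the two alternating patterns on four vertices, the one starting with a positive label
  is excluded by \<open>affine_no_crossing\<close> directly. The other becomes the first when the
  four points are rotated cyclically, which preserves orientation.\<close>

lemma linear_classifier_alternation_free:
  assumes ord: "\<And>i j k. i < j \<Longrightarrow> j < k \<Longrightarrow> k < m \<Longrightarrow> orient (c i) (c j) (c k) > 0"
  shows "alternation_free m (\<lambda>i. linear_classifier w b (c i) = 1)"
proof -
  have cyc: "orient q r p = orient p q r" for p q r
    by (simp add: orient_def algebra_simps)
  have lc: "linear_classifier w b x = 1 \<longleftrightarrow> w \<bullet> x + b > 0" for x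
    by (simp add: linear_classifier_def)
  have False if "i < j" "j < k" "k < l" "l < m"
    "linear_classifier w b (c i) = 1 \<longleftrightarrow> linear_classifier w b (c k) = 1"
    "linear_classifier w b (c j) = 1 \<longleftrightarrow> linear_classifier w b (c l) = 1"
    "\<not> (linear_classifier w b (c i) = 1 \<longleftrightarrow> linear_classifier w b (c j) = 1)" for i j k l
  proof -
    have o: "orient (c i) (c j) (c k) > 0" "orient (c i) (c j) (c l) > 0"
      "orient (c i) (c k) (c l) > 0" "orient (c j) (c k) (c l) > 0"
      using that ord by auto
    have o': "orient (c j) (c k) (c i) > 0" "orient (c j) (c l) (c i) > 0" "orient (c k) (c l) (c i) > 0"
      using o by (simp_all only: cyc)
    show False
      using affine_no_crossing[OF o, of w b] affine_no_crossing[OF o(4) o'(1,2,3), of w b] that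
      unfolding lc by linarith
  qed
  then show ?thesis unfolding alternation_free_def by blast
qed

text \<open>Cyclically, a nonconstant labelling changes value at two places in opposite directions. Agreement
  at the two indices on either side of each of these changes leaves room for a single alternation-free
  labelling.\<close>

lemma alternation_free_determined_by_four:
  assumes "p < m" "q < m" "s p \<noteq> s q"
  obtains I where "I \<subseteq> {..<m}" "card I \<le> 4"
    "\<And>g g' i. alternation_free m g \<Longrightarrow> alternation_free m g' \<Longrightarrow> \<forall>i\<in>I. g i = s i \<and> g' i = s i \<Longrightarrow>
       i < m \<Longrightarrow> g i = g' i"
proof -
  \<comment> \<open>The two changes are from \<open>a - 1\<close> to \<open>a\<close> and from
    \<open>b\<close> to its cyclic successor \<open>d\<close>, which is 0 when \<open>b\<close> is
    the last index.\<close>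
  define L where "L = {i. i < m \<and> s i \<noteq> s 0}"
  define a where "a = Min L"
  define b where "b = Max L"
  define d where "d = (if Suc b < m then Suc b else 0)"
  have L: "finite L" "L \<noteq> {}" using assms by (auto simp: L_def)
  have aL: "a \<in> L" and bL: "b \<in> L" using L by (auto simp: a_def b_def)
  have ab: "a \<le> b" using L aL by (simp add: b_def)
  have a0: "0 < a" using aL by (cases a) (auto simp: L_def)
  have "a - 1 \<notin> L" using Min_le[OF L(1), of "a - 1"] a0 by (auto simp: a_def[symmetric])
  moreover have bm: "b < m" "a < m" using aL bL by (auto simp: L_def)
  ultimately have sa1: "s (a - 1) = s 0" using a0 by (auto simp: L_def)
  have "Suc b \<notin> L" using Max_ge[OF L(1), of "Suc b"] by (auto simp: b_def[symmetric])
  then have sd: "s d = s 0" by (auto simp: L_def d_def)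
  have sa: "s a = (\<not> s 0)" "s b = (\<not> s 0)" using aL bL by (auto simp: L_def)
  define I where "I = {a - 1, a, b, d}"
  \<comment> \<open>The labelling \<open>s\<close> itself may change again between \<open>a\<close>
    and \<open>b\<close>; an alternation-free \<open>g\<close> may not. A wrong value at
    \<open>i\<close> would alternate with three of the four fixed values.\<close>
  have det: "g i = (if a \<le> i \<and> i \<le> b then \<not> s 0 else s 0)"
    if g: "alternation_free m g" and agree: "\<forall>i\<in>I. g i = s i" and i: "i < m" for g i
  proof -
    have g4: "g (a - 1) = s 0" "g a = (\<not> s 0)" "g b = (\<not> s 0)" "g d = s 0"
      using agree sa1 sa sd by (auto simp: I_def)
    note alt = alternation_freeD[OF g]
    consider "a \<le> i" "i \<le> b" | "i < a" | "b < i" by linarith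
    then show ?thesis
    proof cases
      case 1
      have "g i = (\<not> s 0)"
      proof (rule ccontr)
        assume n: "g i \<noteq> (\<not> s 0)"
        then have "i \<noteq> a" "i \<noteq> b" using g4 by auto
        then show False using alt[of "a - 1" a i b] 1 a0 bm g4 n by auto
      qed
      then show ?thesis using 1 by simp
    next
      case 2
      have "g i = s 0"
      proof (rule ccontr)
        assume n: "g i \<noteq> s 0"
        then have "i \<noteq> a - 1" using g4 by auto
        then have i1: "i < a - 1" using 2 by linarith
        show False
        \<comment> \<open>The fourth index of the alternation is \<open>d\<close>: it comes last if
          it is \<open>Suc b\<close>, and first if it wraps around to 0.\<close>
        proof (cases "Suc b < m")
          case True
          then show False using alt[of i "a - 1" a "Suc b"] 2 i1 a0 ab g4 n by (auto simp: d_def)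
        next
          case False
          then have "g 0 = s 0" using g4 by (simp add: d_def)
          moreover from this have "i > 0" using n by (cases i) auto
          ultimately show False using alt[of 0 i "a - 1" a] 2 i1 a0 bm g4 n by auto
        qed
      qed
      then show ?thesis using 2 by simp
    next
      case 3
      then have d: "d = Suc b" using i by (simp add: d_def)
      have "g i = s 0"
      proof (rule ccontr)
        assume n: "g i \<noteq> s 0"
        then have "i \<noteq> d" using g4 by auto
        then show False using alt[of "a - 1" a d i] 3 i d a0 ab g4 n by auto
      qed
      then show ?thesis using 3 by simp
    qed
  qed
  show ?thesis
  proof (rule that)
    show "I \<subseteq> {..<m}" using a0 bm by (auto simp: I_def d_def)
    show "card I \<le> 4" unfolding I_def by (simp add: card_insert_if)
    show "g i = g' i" if "alternation_free m g" "alternation_free m g'"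
      "\<forall>i\<in>I. g i = s i \<and> g' i = s i" "i < m" for g g' i
      using that det[of g i] det[of g' i] by auto
  qed
qed

section \<open>Existence of a balanced test\<close>

text \<open>The geometry enters only through \<open>det\<close>: for every nonconstant labelling
  \<open>s\<close>, at most four tests leave room for only one hypothesis agreeing with
  \<open>s\<close> on them.\<close>

lemma exists_balanced_test:
  fixes X :: "'a set" and V :: "('a \<Rightarrow> nat) set"
  assumes "finite X" "X \<noteq> {}" and V: "V \<subseteq> X \<rightarrow>\<^sub>E {0, 1}" and "card V > 1"
    and bal: "\<And>h. h \<in> V \<Longrightarrow> (\<Sum>x\<in>X. real (h x)) / real (card X) \<in> {1/4..3/4}"
    and det: "\<And>s x y. x \<in> X \<Longrightarrow> y \<in> X \<Longrightarrow> s x \<noteq> s y \<Longrightarrow> \<exists>I\<subseteq>X. card I \<le> 4 \<and>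
      (\<forall>g\<in>V. \<forall>h\<in>V. (\<forall>x\<in>I. (g x = 1) = s x \<and> (h x = 1) = s x) \<longrightarrow> g = h)"
  shows "\<exists>x\<in>X. (\<Sum>h\<in>V. real (h x)) / real (card V) \<in> {1/5..4/5}"
proof (rule ccontr)
  assume contra: "\<not> ?thesis"
  have finV: "finite V" using \<open>card V > 1\<close> card.infinite by fastforce
  define N where "N x = card {h \<in> V. h x = 1}" for x
  have V01: "h x = 0 \<or> h x = 1" if "h \<in> V" "x \<in> X" for h x
    using that V by (auto dest!: subsetD PiE_mem)
  have N: "(\<Sum>h\<in>V. real (h x)) = real (N x)" if "x \<in> X" for x
  proof -
    have "(\<Sum>h\<in>V. real (h x)) = (\<Sum>h\<in>V. if h x = 1 then 1 else 0)"
      using V01 that by (intro sum.cong) force+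
    then show ?thesis using finV by (simp add: N_def sum.If_cases Int_def)
  qed
  \<comment> \<open>As no fraction lies in \<open>{1/5..4/5}\<close>, this is the majority label at
    every test.\<close>
  define s where "s x \<longleftrightarrow> real (N x) > 4/5 * card V" for x
  have lo: "real (N x) < 1/5 * card V" if "x \<in> X" "\<not> s x" for x
  proof -
    have "real (N x) / card V \<notin> {1/5..4/5}" using contra N that by force
    then show ?thesis using that \<open>card V > 1\<close> by (auto simp: s_def divide_simps split: if_splits)
  qed
  \<comment> \<open>Double counting of positive labels: balance puts \<open>T\<close> between 1/4
    and 3/4 of \<open>card V * card X\<close>, while a constant \<open>s\<close> would force at
    least 4/5 or at most 1/5.\<close>
  define T where "T = (\<Sum>x\<in>X. real (N x))"
  have T: "T = (\<Sum>h\<in>V. \<Sum>x\<in>X. real (h x))"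
    unfolding T_def using N by (subst sum.swap) simp
  have cX: "card X > 0" using assms by (simp add: card_gt_0_iff)
  have bal': "card X / 4 \<le> (\<Sum>x\<in>X. real (h x))" "(\<Sum>x\<in>X. real (h x)) \<le> 3/4 * card X" if "h \<in> V" for h
    using bal[OF that] cX by (auto simp: divide_simps)
  have "T \<le> (\<Sum>h\<in>V. 3/4 * card X)" unfolding T by (intro sum_mono bal')
  then have Tu: "T \<le> card V * (3/4 * card X)" by simp
  have "(\<Sum>h\<in>V. card X / 4) \<le> T" unfolding T by (intro sum_mono bal')
  then have Tl: "card V * (card X / 4) \<le> T" by simp
  have prod: "real (card V) * real (card X) > 0" using cX \<open>card V > 1\<close> by simp
  have "\<exists>y\<in>X. \<not> s y"
  proof (rule ccontr)
    assume "\<not> ?thesis"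
    then have "(\<Sum>x\<in>X. 4/5 * card V) \<le> T" unfolding T_def by (intro sum_mono) (auto simp: s_def)
    then show False using Tu prod by (simp add: algebra_simps)
  qed
  moreover have "\<exists>x\<in>X. s x"
  proof (rule ccontr)
    assume "\<not> ?thesis"
    then have "T \<le> (\<Sum>x\<in>X. 1/5 * card V)" unfolding T_def using lo by (intro sum_mono) force
    then show False using Tl prod by (simp add: algebra_simps)
  qed
  ultimately obtain I where I: "I \<subseteq> X" "card I \<le> 4"
    and uniq: "\<And>g h. g \<in> V \<Longrightarrow> h \<in> V \<Longrightarrow> (\<forall>x\<in>I. (g x = 1) = s x \<and> (h x = 1) = s x) \<Longrightarrow> g = h"
    using det[of _ _ s] by metis
  define D where "D x = {h \<in> V. (h x = 1) \<noteq> s x}" for x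
  have D: "5 * card (D x) < card V" if "x \<in> X" for x
  proof (cases "s x")
    case True
    have "card V = N x + card (D x)"
      unfolding N_def D_def using True finV
      by (subst card_Un_disjoint[symmetric]) (auto intro!: arg_cong[where f = card])
    then show ?thesis using True by (simp add: s_def)
  next
    case False
    then have "card (D x) = N x" by (simp add: D_def N_def)
    then show ?thesis using lo[OF that False] by simp
  qed
  define A where "A = V - (\<Union>x\<in>I. D x)"
  have finI: "finite I" using I(1) \<open>finite X\<close> by (rule finite_subset)
  have "card A \<le> 1"
  proof -
    have "g = h" if "g \<in> A" "h \<in> A" for g h
      using that uniq[of g h] by (auto simp: A_def D_def)
    then show ?thesis using finV by (simp add: A_def card_le_Suc0_iff_eq)
  qed
  moreover have cardV: "card V \<le> card A + (\<Sum>x\<in>I. card (D x))"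
  proof -
    have "card V \<le> card (A \<union> (\<Union>x\<in>I. D x))"
      using finV finI by (intro card_mono) (auto simp: A_def D_def)
    also have "\<dots> \<le> card A + card (\<Union>x\<in>I. D x)" by (rule card_Un_le)
    also have "card (\<Union>x\<in>I. D x) \<le> (\<Sum>x\<in>I. card (D x))" by (rule card_UN_le[OF finI])
    finally show ?thesis by simp
  qed
  \<comment> \<open>Integrality turns the strict bound \<open>D\<close> into one with
    \<open>card V - 1\<close>, which can be summed even over an empty \<open>I\<close>. With
    \<open>card A \<le> 1\<close> and \<open>card I \<le> 4\<close> it yields
    \<open>5 * card V \<le> 5 + 4 * (card V - 1)\<close>.\<close>
  moreover have "(\<Sum>x\<in>I. 5 * card (D x)) \<le> (\<Sum>x\<in>I. card V - 1)"
    using D I by (intro sum_mono) fastforce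
  then have "5 * (\<Sum>x\<in>I. card (D x)) \<le> card I * (card V - 1)"
    by (simp add: sum_distrib_left)
  moreover have "card I * (card V - 1) \<le> 4 * (card V - 1)" using I by simp
  ultimately have "card V < 5" using \<open>card V > 1\<close> by linarith
  then have D0: "D x = {}" if "x \<in> X" for x
  proof -
    have "card (D x) = 0" using D[OF that] \<open>card V < 5\<close> by linarith
    moreover have "finite (D x)" using finV by (simp add: D_def)
    ultimately show ?thesis by simp
  qed
  have "g = h" if "g \<in> V" "h \<in> V" for g h
    using that D0 I by (intro uniq) (auto simp: D_def)
  then show False using \<open>card V > 1\<close> finV card_le_Suc0_iff_eq[of V] by force
qed

section \<open>Cost of Generalized Binary Search\<close>

text \<open>The chosen test is at least as close to 1/2 as the balanced one, so either answer keeps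
  at most 4/5 of \<open>V\<close>. The target survives every answer, which keeps \<open>V\<close>
  nonempty.\<close>

lemma gbs_reach_card_le:
  fixes X :: "'a set"
  assumes "finite H" and H: "H \<subseteq> X \<rightarrow>\<^sub>E {0, 1}" and "hs \<in> H"
    and split: "\<And>V. V \<subseteq> H \<Longrightarrow> card V > 1 \<Longrightarrow>
      \<exists>x\<in>X. (\<Sum>h\<in>V. real (h x)) / real (card V) \<in> {1/5..4/5}"
    and "gbs_reach X H hs k V"
  shows "V \<subseteq> H \<and> hs \<in> V \<and> real (card V) \<le> (4/5) ^ k * real (card H)"
  using assms(5)
proof induction
  case init
  then show ?case using assms by simp
next
  case (query k V x)
  define p where "p x = (\<Sum>h\<in>V. real (h x)) / real (card V)" for x
  obtain y where y: "y \<in> X" "p y \<in> {1/5..4/5}"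
    using split[of V] query by (auto simp: p_def)
  have xX: "x \<in> X" and "\<not> \<bar>p y - 1/2\<bar> < \<bar>p x - 1/2\<bar>"
    using query(3) y unfolding gbs_test_def is_arg_min_def p_def by auto
  then have p: "1/5 \<le> p x" "p x \<le> 4/5"
    using y by (auto simp: abs_if field_simps split: if_splits)
  have finV: "finite V" using query assms finite_subset by blast
  have V01: "h x = 0 \<or> h x = 1" if "h \<in> V" for h
    using that H query.IH xX by (auto dest!: subsetD PiE_mem)
  have "(\<Sum>h\<in>V. real (h x)) = (\<Sum>h\<in>V. if h x = 1 then 1 else 0)"
    using V01 by (intro sum.cong) force+
  also have "\<dots> = card {h \<in> V. h x = 1}"
    using finV by (simp add: sum.If_cases Int_def)
  finally have one: "card {h \<in> V. h x = 1} = p x * card V"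
    using query by (simp add: p_def)
  have "V = {h \<in> V. h x = 1} \<union> {h \<in> V. h x = 0}" using V01 by blast
  then have "card V = card ({h \<in> V. h x = 1} \<union> {h \<in> V. h x = 0})" by simp
  also have "\<dots> = card {h \<in> V. h x = 1} + card {h \<in> V. h x = 0}"
    using finV by (intro card_Un_disjoint) auto
  finally have "real (card {h \<in> V. h x = 0}) = (1 - p x) * card V"
    using one by (simp add: algebra_simps)
  moreover have "hs x = 0 \<or> hs x = 1" using V01 query.IH by blast
  moreover have "p x * card V \<le> 4/5 * card V" "(1 - p x) * card V \<le> 4/5 * card V"
    using p by (intro mult_right_mono; simp)+
  ultimately have "real (card {h \<in> V. h x = hs x}) \<le> 4/5 * card V"
    using one by auto
  also have "\<dots> \<le> (4/5) ^ Suc k * real (card H)" using query.IH by simp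
  finally show ?case using query.IH by auto
qed

text \<open>After \<open>k\<close> queries the target is still present, so
  \<open>1 \<le> (4/5) ^ k * card H\<close>; taking logarithms bounds \<open>k\<close>.\<close>

lemma gbs_worst_case_cost_le:
  fixes X :: "'a set"
  assumes "finite H" and "H \<subseteq> X \<rightarrow>\<^sub>E {0, 1}"
    and "\<And>V. V \<subseteq> H \<Longrightarrow> card V > 1 \<Longrightarrow>
      \<exists>x\<in>X. (\<Sum>h\<in>V. real (h x)) / real (card V) \<in> {1/5..4/5}"
  shows "ereal_of_enat (gbs_worst_case_cost H X) \<le> ereal (log 2 (card H) / (- log 2 (1 - 1/5)))"
proof -
  define B where "B = log 2 (card H) / (- log 2 (1 - 1/5))"
  have neg: "log 2 (4/5) < (0::real)" by simp
  have B0: "B \<ge> 0"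
  proof (cases "card H = 0")
    case False
    then show ?thesis using neg by (auto simp: B_def divide_nonneg_neg)
  qed (simp add: B_def log_def)
  have kB: "real k \<le> B" if "hs \<in> H" "gbs_reach X H hs k V" for hs k V
  proof -
    have V: "V \<subseteq> H" "hs \<in> V" "real (card V) \<le> (4/5) ^ k * real (card H)"
      using gbs_reach_card_le[OF assms(1,2) that(1) assms(3) that(2)] by auto
    then have "card V \<ge> 1" using assms(1) by (metis card_0_eq empty_iff finite_subset less_one not_less)
    then have le: "1 \<le> (4/5) ^ k * real (card H)" using V by linarith
    have cH: "card H > 0" using that assms(1) card_gt_0_iff by blast
    have "0 \<le> log 2 ((4/5) ^ k * real (card H))" using le by simp
    also have "\<dots> = k * log 2 (4/5) + log 2 (card H)"
      using cH by (simp add: log_mult log_nat_power)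
    finally show ?thesis using neg by (simp add: B_def field_simps)
  qed
  \<comment> \<open>The cost is a supremum in \<open>enat\<close>, so the real bound is first
    rounded down to a natural number.\<close>
  have "gbs_worst_case_cost H X \<le> enat (nat \<lfloor>B\<rfloor>)"
    unfolding gbs_worst_case_cost_def using kB by (intro SUP_least) (auto simp: le_nat_floor)
  then have "ereal_of_enat (gbs_worst_case_cost H X) \<le> ereal_of_enat (enat (nat \<lfloor>B\<rfloor>))"
    by (simp only: ereal_of_enat_le_iff)
  also have "\<dots> \<le> ereal B" using B0 by simp
  finally show ?thesis by (simp add: B_def)
qed

section \<open>The bound for polygon vertices and the numerical constant\<close>

theorem mainTheorem4:
  fixes P :: "(real ^ 2) set" and X :: "(real ^ 2) set" and m n :: nat
    and H :: "(real ^ 2 \<Rightarrow> nat) set"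
  assumes "polytope P"
    and "X = {v. v extreme_point_of P}"
    and "card X = m" and "m \<ge> 3"
    and "H = balanced_linear_hyps X"
    and "n = card H"
  shows "ereal_of_enat (gbs_worst_case_cost H X) \<le> ereal (log 2 (real n) / (- log 2 (1 - 1/5)))
    \<and> log 2 (real n) / (- log 2 (1 - 1/5)) \<le> 3.2 * log 2 (real n)"
proof
  have finX: "finite X" and X0: "X \<noteq> {}"
    using assms(3,4) by (auto intro: card_ge_0_finite)
  obtain c where c: "bij_betw c {..<m} X"
    and ord: "\<And>i j k. i < j \<Longrightarrow> j < k \<Longrightarrow> k < m \<Longrightarrow> orient (c i) (c j) (c k) > 0"
    using exists_counterclockwise_enumeration[OF assms(1,2) X0] assms(3) by metis
  have HP: "H \<subseteq> X \<rightarrow>\<^sub>E {0, 1}"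
    by (auto simp: assms(5) balanced_linear_hyps_def linear_classifier_def)
  then have finH: "finite H"
    using finX by (auto intro: finite_subset finite_PiE)
  have cX: "c i \<in> X" if "i < m" for i
    using c that by (auto simp: bij_betw_def)
  have free: "alternation_free m (\<lambda>i. h (c i) = 1)" if h: "h \<in> H" for h
  proof -
    obtain w b where "h = restrict (linear_classifier w b) X"
      using h by (auto simp: assms(5) balanced_linear_hyps_def)
    then show ?thesis
      using linear_classifier_alternation_free[of m c w b] ord cX
      unfolding alternation_free_def by simp
  qed
  \<comment> \<open>The labelling \<open>s\<close> is pulled back to indices along \<open>c\<close>,
    and the four indices found there are mapped back to vertices.\<close>
  have det: "\<exists>I\<subseteq>X. card I \<le> 4 \<and>
      (\<forall>g\<in>H. \<forall>h\<in>H. (\<forall>x\<in>I. (g x = 1) = s x \<and> (h x = 1) = s x) \<longrightarrow> g = h)"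
    if xy: "x \<in> X" "y \<in> X" "s x \<noteq> s y" for s x y
  proof -
    obtain p q where pq: "p < m" "q < m" "x = c p" "y = c q"
      using c xy by (auto simp: bij_betw_def)
    obtain I where I: "I \<subseteq> {..<m}" "card I \<le> 4"
      and uniq: "\<And>g g' i. alternation_free m g \<Longrightarrow> alternation_free m g' \<Longrightarrow>
        \<forall>i\<in>I. g i = s (c i) \<and> g' i = s (c i) \<Longrightarrow> i < m \<Longrightarrow> g i = g' i"
      using alternation_free_determined_by_four[OF pq(1,2), of "\<lambda>i. s (c i)"] xy(3) pq(3,4) by blast
    have "g = h" if gh: "g \<in> H" "h \<in> H" "\<forall>x\<in>c ` I. (g x = 1) = s x \<and> (h x = 1) = s x" for g h
    proof (rule PiE_ext)
      show "g \<in> X \<rightarrow>\<^sub>E {0, 1}" "h \<in> X \<rightarrow>\<^sub>E {0, 1}" using gh HP by blast+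
      fix x assume "x \<in> X"
      then obtain i where i: "i < m" "x = c i" using c by (auto simp: bij_betw_def)
      then have "(g x = 1) = (h x = 1)"
        using uniq[OF free[OF gh(1)] free[OF gh(2)]] gh(3) by auto
      moreover have "g x \<in> {0, 1}" "h x \<in> {0, 1}"
        using gh HP \<open>x \<in> X\<close> by (meson subsetD PiE_mem)+
      ultimately show "g x = h x" by auto
    qed
    moreover have "c ` I \<subseteq> X" using I cX by auto
    moreover have "card (c ` I) \<le> 4"
      using I card_image_le[of I c] finite_subset[of I "{..<m}"] by force
    ultimately show ?thesis by blast
  qed
  \<comment> \<open>Balance and \<open>det\<close> pass from \<open>H\<close> to every subset, in
    particular to every version space.\<close>
  have split: "\<exists>x\<in>X. (\<Sum>h\<in>V. real (h x)) / real (card V) \<in> {1/5..4/5}"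
    if V: "V \<subseteq> H" "card V > 1" for V
  proof (rule exists_balanced_test[OF finX X0])
    show "(\<Sum>x\<in>X. real (h x)) / real (card X) \<in> {1/4..3/4}" if "h \<in> V" for h
      using that V unfolding assms(5) balanced_linear_hyps_def by auto
    show "\<exists>I\<subseteq>X. card I \<le> 4 \<and>
        (\<forall>g\<in>V. \<forall>h\<in>V. (\<forall>x\<in>I. (g x = 1) = s x \<and> (h x = 1) = s x) \<longrightarrow> g = h)"
      if xy: "x \<in> X" "y \<in> X" "s x \<noteq> s y" for s x y
      using det[of x y s, OF xy] V(1) by (meson subsetD)
  qed (use V HP in auto)
  show "ereal_of_enat (gbs_worst_case_cost H X) \<le> ereal (log 2 (real n) / (- log 2 (1 - 1/5)))"
    unfolding assms(6) by (rule gbs_worst_case_cost_le[OF finH HP split])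
  \<comment> \<open>The factor 3.2 is 16/5, so the claim rests on
    \<open>(5/4) ^ 16 \<ge> 2 ^ 5\<close>.\<close>
  have "16 * log 2 (5/4 :: real) = log 2 ((5/4) ^ 16)"
    by (simp add: log_nat_power)
  moreover have "log 2 (2 ^ 5) \<le> log 2 ((5/4 :: real) ^ 16)"
    by (subst log_le_cancel_iff) (simp_all add: power_divide)
  moreover have "log 2 (2 ^ 5 :: real) = 5"
    by (subst log_nat_power) simp_all
  ultimately have "log 2 (5/4 :: real) \<ge> 5/16" by linarith
  moreover have "- log 2 (1 - 1/5 :: real) = log 2 (5/4)"
    by (simp add: log_divide)
  ultimately have l: "- log 2 (1 - 1/5 :: real) \<ge> 5/16" by simp
  \<comment> \<open>For \<open>n = 0\<close> the logarithm has the default value 0.\<close>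
  have "log 2 (real n) \<ge> 0"
    by (cases "n = 0") (simp_all add: log_def)
  then have "log 2 (real n) / (- log 2 (1 - 1/5)) \<le> log 2 (real n) / (5/16)"
    using l by (intro divide_left_mono) auto
  then show "log 2 (real n) / (- log 2 (1 - 1/5)) \<le> 3.2 * log 2 (real n)"
    by simp
qed

end
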